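(* For integers $r,s$ with $\sqrt{r\log r}\le s$ and $s=o(r)$ (i.e. $s/r\to 0$), and $n$ large enough in terms of $r$, we have $$f(n,r,s)=\left(1-e^{-\Theta(s^2/r)}\right)n,$$ that is, there are absolute constants $c,C>0$ with $\left(1-e^{-c s^2/r}\right)n\le f(n,r,s)\le \left(1-e^{-C s^2/r}\right)n$ in this range.
   Context: An $r$-edge colouring of $K_n$ assigns to each edge one of $r$ colours. $f(n,r,s)$ denotes the largest integer $m$ such that in every $r$-edge colouring of $K_n$ there exist a set $S$ of at most $s$ colours and a connected subgraph of $K_n$ on at least $m$ vertices all of whose edges have colours in $S$. Logarithms are base $2$. *)

theory Defs
  imports Complex_Main "HOL-Library.Landau_Symbols"
begin

text \<open>The complete graph \<open>K\<^sub>n\<close> has vertex set \<open>{..<n}\<close>; edges are two-element vertex sets.\<close>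

definition complete_edges :: "nat \<Rightarrow> nat set set" where
  "complete_edges n = {e. e \<subseteq> {..<n} \<and> card e = 2}"

text \<open>The colours are \<open>0, \<dots>, r - 1\<close>, and a colouring need not use all of them. The values of
  \<open>\<chi>\<close> outside \<open>complete_edges n\<close> are irrelevant.\<close>

definition edge_colouring :: "nat \<Rightarrow> nat \<Rightarrow> (nat set \<Rightarrow> nat) \<Rightarrow> bool" where
  "edge_colouring n r \<chi> \<longleftrightarrow> (\<forall>e\<in>complete_edges n. \<chi> e < r)"

text \<open>A subgraph is given by its vertex set \<open>W\<close> and its edge set \<open>F\<close>; it need not be induced
  or spanning.\<close>

definition subgraph_of_complete :: "nat \<Rightarrow> nat set \<Rightarrow> nat set set \<Rightarrow> bool" where
  "subgraph_of_complete n W F \<longleftrightarrow> W \<subseteq> {..<n} \<and> F \<subseteq> complete_edges n \<and> (\<forall>e\<in>F. e \<subseteq> W)"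

text \<open>The empty graph is not connected; a single vertex without edges is.\<close>

definition connected_graph :: "'a set \<Rightarrow> 'a set set \<Rightarrow> bool" where
  "connected_graph W F \<longleftrightarrow> W \<noteq> {} \<and> (\<forall>u\<in>W. \<forall>v\<in>W. (u, v) \<in> {(x, y). {x, y} \<in> F}\<^sup>*)"

text \<open>For \<open>n \<ge> 1\<close> and \<open>r \<ge> 1\<close> the integers \<open>m\<close> in question include \<open>1\<close> and are bounded by \<open>n\<close>,
  so that the greatest one exists. For \<open>n = 0\<close> there is none, and for \<open>r = 0\<close>, \<open>n \<ge> 2\<close> there are no
  colourings, so the value is unspecified in these degenerate cases.\<close>

definition f :: "nat \<Rightarrow> nat \<Rightarrow> nat \<Rightarrow> nat" where
  "f n r s = (GREATEST m. \<forall>\<chi>. edge_colouring n r \<chi> \<longrightarrow>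
     (\<exists>S W F. S \<subseteq> {..<r} \<and> card S \<le> s \<and>
        subgraph_of_complete n W F \<and> connected_graph W F \<and>
        m \<le> card W \<and> (\<forall>e\<in>F. \<chi> e \<in> S)))"

end

theory Submission
  imports Defs
begin

text \<open>Write \<open>L = s\<^sup>2 / r\<close>.

  Lower bound: suppose that no \<open>s\<close> colours have a component of size \<open>(1 - \<epsilon>) n\<close>. Then at each vertex
  no \<open>s\<close> colours cover almost all edges, so a greedy choice of about \<open>s / 10\<close> colours, guided by an
  exponential potential, gives all but \<open>\<epsilon> n\<close> vertices degree at least about \<open>\<epsilon> n / s\<close>; these vertices
  lie in \<open>O(s / \<epsilon>)\<close> components. More than \<open>s\<close> colours cross any cut of these vertices, for the crossing
  colours connect them. Hence some colour merges components so that their number drops by the factor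
  \<open>1 - s / (2 r)\<close>, and the remaining colours bring it down to one, a contradiction. Starting
  from \<open>O(s / \<epsilon>)\<close> components, rather than the more obvious \<open>O(r / \<epsilon>)\<close>, is what makes the number
  of colours sufficient.

  Upper bound: there are \<open>e\<^bsup>O(L)\<^esup>\<close> pairwise intersecting \<open>10 s\<close>-subsets (palettes) of the colours
  such that every set of \<open>s\<close> colours is disjoint from one of them: random palettes are disjoint from
  each other with probability at most \<open>e\<^bsup>-100 L\<^esup>\<close>, but from a given set of \<open>s\<close> colours with
  probability at least \<open>e\<^bsup>-40 L\<^esup>\<close>. Assign palettes evenly to the vertices and colour each edge from
  the intersection of the palettes of its ends.\<close>

section \<open>Components of few colours\<close>

definition colour_rel :: "nat \<Rightarrow> (nat set \<Rightarrow> nat) \<Rightarrow> nat set \<Rightarrow> (nat \<times> nat) set" where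
  "colour_rel n \<chi> S = {(x, y). x < n \<and> y < n \<and> x \<noteq> y \<and> \<chi> {x, y} \<in> S}"

text \<open>For \<open>v \<ge> n\<close> this is the singleton \<open>{v}\<close>, so the rules of
  an equivalence relation hold without bounds on the vertices.\<close>

definition component :: "nat \<Rightarrow> (nat set \<Rightarrow> nat) \<Rightarrow> nat set \<Rightarrow> nat \<Rightarrow> nat set" where
  "component n \<chi> S v = {w. (v, w) \<in> (colour_rel n \<chi> S)\<^sup>*}"

lemma colour_less:
  assumes "edge_colouring n r \<chi>" "x < n" "y < n" "x \<noteq> y"
  shows "\<chi> {x, y} < r"
  using assms by (auto simp: edge_colouring_def complete_edges_def)

lemma sym_colour_rel: "sym (colour_rel n \<chi> S)"
  by (auto simp: colour_rel_def sym_def insert_commute)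

lemma component_self: "v \<in> component n \<chi> S v"
  by (simp add: component_def)

lemma component_sym: "w \<in> component n \<chi> S v \<longleftrightarrow> v \<in> component n \<chi> S w"
  using sym_rtrancl[OF sym_colour_rel[of n \<chi> S]] by (auto simp: component_def sym_def)

lemma component_trans:
  "\<lbrakk>w \<in> component n \<chi> S v; x \<in> component n \<chi> S w\<rbrakk> \<Longrightarrow> x \<in> component n \<chi> S v"
  by (auto simp: component_def)

lemma component_eq: "w \<in> component n \<chi> S v \<Longrightarrow> component n \<chi> S w = component n \<chi> S v"
  by (meson component_sym component_trans subsetI subset_antisym)

lemma component_edge:
  "\<lbrakk>v < n; w < n; v \<noteq> w; \<chi> {v, w} \<in> S\<rbrakk> \<Longrightarrow> w \<in> component n \<chi> S v"
  by (auto simp: component_def colour_rel_def)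

lemma component_mono: "S \<subseteq> S' \<Longrightarrow> component n \<chi> S v \<subseteq> component n \<chi> S' v"
  using rtrancl_mono[of "colour_rel n \<chi> S" "colour_rel n \<chi> S'"]
  unfolding component_def colour_rel_def by blast

lemma component_subset:
  assumes "v < n" shows "component n \<chi> S v \<subseteq> {..<n}"
proof
  fix w assume "w \<in> component n \<chi> S v"
  hence "(v, w) \<in> (colour_rel n \<chi> S)\<^sup>*" by (simp add: component_def)
  thus "w \<in> {..<n}" using assms by (induction rule: rtrancl_induct) (auto simp: colour_rel_def)
qed

lemma finite_component: "v < n \<Longrightarrow> finite (component n \<chi> S v)"
  using finite_subset[OF component_subset finite_lessThan] .

text \<open>A path from \<open>v\<close> never leaves the component of \<open>v\<close>, so its
  edges lie in \<open>F\<close>; by symmetry any two vertices are then joined through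
  \<open>v\<close>.\<close>

lemma component_subgraph:
  fixes \<chi> :: "nat set \<Rightarrow> nat" and S :: "nat set"
  assumes "v < n"
  defines "W \<equiv> component n \<chi> S v"
  defines "F \<equiv> {e \<in> complete_edges n. e \<subseteq> W \<and> \<chi> e \<in> S}"
  shows "subgraph_of_complete n W F" "connected_graph W F" "\<forall>e\<in>F. \<chi> e \<in> S"
proof -
  show "subgraph_of_complete n W F" "\<forall>e\<in>F. \<chi> e \<in> S"
    using component_subset[OF assms(1)] by (auto simp: subgraph_of_complete_def F_def W_def)
  let ?R = "{(x, y). {x, y} \<in> F}"
  have reach: "(v, w) \<in> ?R\<^sup>*" if "w \<in> W" for w
  proof -
    have "(v, w) \<in> (colour_rel n \<chi> S)\<^sup>*" using that by (simp add: W_def component_def)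
    thus ?thesis
    proof (induction rule: rtrancl_induct)
      case (step y z)
      have "y \<in> W" "z \<in> W" using step(1,2) by (auto simp: W_def component_def)
      hence "(y, z) \<in> ?R"
        using step(2) by (auto simp: colour_rel_def F_def complete_edges_def)
      thus ?case using step(3) by (rule rtrancl_into_rtrancl[rotated])
    qed simp
  qed
  have "sym (?R\<^sup>*)" by (rule sym_rtrancl) (auto simp: sym_def insert_commute)
  show "connected_graph W F"
    unfolding connected_graph_def
  proof (intro conjI ballI)
    show "W \<noteq> {}" using component_self[of v n \<chi> S] by (auto simp: W_def)
    fix x y assume "x \<in> W" "y \<in> W"
    thus "(x, y) \<in> ?R\<^sup>*"
      using symD[OF \<open>sym (?R\<^sup>*)\<close> reach] reach by (meson rtrancl_trans)
  qed
qed

text \<open>\<open>GREATEST\<close> is meaningful because \<open>P\<close> holds at 0 and is bounded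
  by \<open>n\<close>.\<close>

lemma f_greatest:
  fixes n r s :: nat
  assumes "0 < n" "0 < r"
  defines "P \<equiv> \<lambda>m. \<forall>\<chi>. edge_colouring n r \<chi> \<longrightarrow>
     (\<exists>S W F. S \<subseteq> {..<r} \<and> card S \<le> s \<and>
        subgraph_of_complete n W F \<and> connected_graph W F \<and>
        m \<le> card W \<and> (\<forall>e\<in>F. \<chi> e \<in> S))"
  shows "P (f n r s)" "P m \<Longrightarrow> m \<le> f n r s"
proof -
  have bound: "y \<le> n" if "P y" for y
  proof -
    note that
    \<comment> \<open>Some colouring must exist, since otherwise \<open>P\<close> would hold
      vacuously for every number.\<close>
    moreover have "edge_colouring n r (\<lambda>_. 0)" using assms by (simp add: edge_colouring_def)
    ultimately obtain W F where "subgraph_of_complete n W F" "y \<le> card W"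
      unfolding P_def by blast
    thus "y \<le> n" using card_mono[of "{..<n}" W] by (auto simp: subgraph_of_complete_def)
  qed
  have P0: "P 0"
    unfolding P_def using assms(1)
    by (intro allI impI exI[of _ "{}"] exI[of _ "{0}"])
      (auto simp: subgraph_of_complete_def connected_graph_def)
  have f_eq: "f n r s = (GREATEST m. P m)" by (simp add: f_def P_def)
  show "P (f n r s)" unfolding f_eq by (rule GreatestI_nat[where P = P, OF P0 bound])
  show "P m \<Longrightarrow> m \<le> f n r s" unfolding f_eq by (rule Greatest_le_nat[where P = P, OF _ bound])
qed

lemma f_ge:
  assumes "0 < n" "0 < r"
    and big: "\<And>\<chi>. edge_colouring n r \<chi> \<Longrightarrow>
      \<exists>S v. S \<subseteq> {..<r} \<and> card S \<le> s \<and> v < n \<and> x \<le> real (card (component n \<chi> S v))"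
  shows "x \<le> real (f n r s)"
proof -
  have "nat \<lceil>x\<rceil> \<le> f n r s"
  proof (rule f_greatest(2)[OF assms(1,2)], intro allI impI)
    fix \<chi> assume "edge_colouring n r \<chi>"
    from big[OF this] obtain S v where S: "S \<subseteq> {..<r}" "card S \<le> s" "v < n"
      "x \<le> real (card (component n \<chi> S v))" by blast
    have "nat \<lceil>x\<rceil> \<le> card (component n \<chi> S v)" using S(4) by (simp add: nat_le_iff ceiling_le_iff)
    thus "\<exists>S W F. S \<subseteq> {..<r} \<and> card S \<le> s \<and> subgraph_of_complete n W F \<and> connected_graph W F \<and>
       nat \<lceil>x\<rceil> \<le> card W \<and> (\<forall>e\<in>F. \<chi> e \<in> S)"
      using S(1,2) component_subgraph[OF S(3)] by blast
  qed
  thus ?thesis by linarith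
qed

section \<open>The lower bound\<close>

lemma exists_ge_average:
  fixes a :: "nat \<Rightarrow> real"
  assumes "0 < r" "b \<le> (\<Sum>i<r. a i)"
  shows "\<exists>i<r. b / real r \<le> a i"
proof (rule ccontr)
  assume "\<not> ?thesis"
  hence "(\<Sum>i<r. a i) < (\<Sum>i<r. b / real r)"
    using assms(1) by (intro sum_strict_mono) (auto simp: not_le)
  thus False using assms by simp
qed

text \<open>\<open>exp (- x)\<close> is at most \<open>1 / (1 + x)\<close>, and
  \<open>x / (1 + x)\<close> is at least half of \<open>min 1 x\<close>. This turns exponential
  weights into truncated linear ones.\<close>

lemma one_minus_exp_ge:
  fixes x :: real
  assumes "0 \<le> x"
  shows "min 1 x / 2 \<le> 1 - exp (- x)"
proof -
  have "exp (- x) \<le> 1 / (1 + x)"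
    using exp_ge_add_one_self[of x] assms by (simp add: exp_minus field_simps)
  moreover have "min 1 x / 2 \<le> 1 - 1 / (1 + x)"
    using assms by (auto simp: min_def field_simps mult_left_le)
  ultimately show ?thesis by linarith
qed

text \<open>A fibre of \<open>h\<close> that meets \<open>T\<close> has at least two elements, so
  its size \<open>m\<close> satisfies \<open>2 + m \<le> 2 * m\<close>; any other fibre satisfies
  \<open>2 \<le> 2 * m\<close>. In the application a new colour merges components, and
  \<open>T\<close> consists of those it leaves.\<close>

lemma card_image_merged:
  assumes "finite Q" "T \<subseteq> Q"
    and merged: "\<And>D. D \<in> T \<Longrightarrow> \<exists>D'\<in>Q. D' \<noteq> D \<and> h D' = h D"
  shows "2 * card (h ` Q) + card T \<le> 2 * card Q"
proof -
  have fT: "finite T" using finite_subset[OF assms(2,1)] .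
  have fibre: "2 + card {D\<in>T. h D = q} \<le> 2 * card {D\<in>Q. h D = q}" if "q \<in> h ` Q" for q
  proof (cases "{D\<in>T. h D = q} = {}")
    case True
    have "card {D\<in>Q. h D = q} > 0" using that assms(1) by (auto simp: card_gt_0_iff)
    thus ?thesis unfolding True by simp
  next
    case False
    then obtain D where D: "D \<in> T" "h D = q" by blast
    obtain D' where "D' \<in> Q" "D' \<noteq> D" "h D' = q" using merged[OF D(1)] D by blast
    hence "card {D, D'} \<le> card {D\<in>Q. h D = q}"
      using D assms by (intro card_mono) auto
    moreover have "card {D\<in>T. h D = q} \<le> card {D\<in>Q. h D = q}"
      using assms by (intro card_mono) auto
    ultimately show ?thesis using \<open>D' \<noteq> D\<close> by simp
  qed
  have "card Q = (\<Sum>q\<in>h ` Q. card {D\<in>Q. h D = q})"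
    using sum.group[of Q "h ` Q" h "\<lambda>_. 1::nat"] assms(1) by simp
  moreover have "card T = (\<Sum>q\<in>h ` Q. card {D\<in>T. h D = q})"
    using sum.group[of T "h ` Q" h "\<lambda>_. 1::nat"] assms(1) fT image_mono[OF assms(2), of h]
    by simp
  moreover have "(\<Sum>q\<in>h ` Q. 2 + card {D\<in>T. h D = q}) \<le> (\<Sum>q\<in>h ` Q. 2 * card {D\<in>Q. h D = q})"
    by (intro sum_mono fibre)
  ultimately show ?thesis by (simp only: sum.distrib sum_distrib_left[symmetric] sum_constant) simp
qed

text \<open>The situation to be refuted for the lower bound, with
  \<open>\<epsilon> = exp (- (L / 200))\<close>.\<close>

locale small_components =
  fixes n r s :: nat and \<chi> :: "nat set \<Rightarrow> nat" and \<epsilon> :: real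
  assumes colouring: "edge_colouring n r \<chi>"
    and small: "\<And>S v. \<lbrakk>S \<subseteq> {..<r}; card S \<le> s; v < n\<rbrakk> \<Longrightarrow>
      real (card (component n \<chi> S v)) < (1 - \<epsilon>) * real n"
    and eps: "0 < \<epsilon>" and n_pos: "0 < n" and r_pos: "0 < r"
begin

section \<open>Degrees in few colours and the greedy potential\<close>

definition deg :: "nat \<Rightarrow> nat set \<Rightarrow> nat" where
  "deg v S = card {w. w < n \<and> w \<noteq> v \<and> \<chi> {v, w} \<in> S}"

lemma deg_sum:
  assumes "finite S" shows "deg v S = (\<Sum>i\<in>S. deg v {i})"
proof -
  have "{w. w < n \<and> w \<noteq> v \<and> \<chi> {v, w} \<in> S} = (\<Union>i\<in>S. {w. w < n \<and> w \<noteq> v \<and> \<chi> {v, w} = i})"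
    by auto
  moreover have "card (\<Union>i\<in>S. {w. w < n \<and> w \<noteq> v \<and> \<chi> {v, w} = i}) =
      (\<Sum>i\<in>S. card {w. w < n \<and> w \<noteq> v \<and> \<chi> {v, w} = i})"
    using assms by (intro card_UN_disjoint) auto
  ultimately show ?thesis unfolding deg_def by simp
qed

lemma deg_less_component:
  assumes "v < n" shows "deg v S < card (component n \<chi> S v)"
proof -
  have "insert v {w. w < n \<and> w \<noteq> v \<and> \<chi> {v, w} \<in> S} \<subseteq> component n \<chi> S v"
    using assms by (auto intro: component_edge component_self)
  from card_mono[OF finite_component[OF assms] this] show ?thesis by (simp add: deg_def)
qed

lemma deg_all:
  assumes "v < n" shows "deg v {..<r} = n - 1"
proof -
  have "{w. w < n \<and> w \<noteq> v \<and> \<chi> {v, w} \<in> {..<r}} = {..<n} - {v}"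
    using assms colour_less[OF colouring] by auto
  thus ?thesis using assms by (simp add: deg_def)
qed

text \<open>The component of \<open>v\<close> contains \<open>v\<close> besides its neighbours, so
  \<open>deg v S + 1 < (1 - \<epsilon>) * n\<close>; the extra one cancels the deficit in
  \<open>deg v {..<r} = n - 1\<close>.\<close>

lemma outside_mass:
  assumes "S \<subseteq> {..<r}" "card S \<le> s" "v < n"
  shows "\<epsilon> * real n \<le> (\<Sum>i\<in>{..<r} - S. real (deg v {i}))"
proof -
  have fS: "finite S" using finite_subset[OF assms(1) finite_lessThan] .
  have "real (deg v S) + 1 < (1 - \<epsilon>) * real n"
    using deg_less_component[OF assms(3), of S] small[OF assms] by linarith
  moreover have "(\<Sum>i\<in>{..<r} - S. real (deg v {i})) = real (deg v {..<r}) - real (deg v S)"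
    using deg_sum[of "{..<r}" v] deg_sum[OF fS, of v] sum.subset_diff[OF assms(1), of "\<lambda>i. real (deg v {i})"]
    by simp
  ultimately show ?thesis using deg_all[OF assms(3)] n_pos by (simp add: algebra_simps of_nat_diff)
qed

text \<open>If few of the colours outside \<open>S\<close> are popular at \<open>v\<close>, then those and \<open>S\<close> together leave out
  much of the neighbourhood of \<open>v\<close>, because they are at most \<open>s\<close> colours.\<close>

lemma weight_gain:
  assumes "S \<subseteq> {..<r}" "0 < \<sigma>" "real (card S) + 2 * \<sigma> \<le> real s" "v < n"
  defines "t \<equiv> \<epsilon> * real n / (2 * \<sigma>)"
  shows "\<sigma> \<le> (\<Sum>i\<in>{..<r} - S. 1 - exp (- (real (deg v {i}) / t)))"
proof -
  have t: "0 < t" using eps n_pos assms(2) by (simp add: t_def)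
  define L where "L = {i \<in> {..<r} - S. t \<le> real (deg v {i})}"
  have L_sub: "L \<subseteq> {..<r} - S" by (auto simp: L_def)
  have ge: "(\<Sum>i\<in>X. min 1 (real (deg v {i}) / t) / 2) \<le> (\<Sum>i\<in>{..<r} - S. 1 - exp (- (real (deg v {i}) / t)))"
    if "X \<subseteq> {..<r} - S" for X
  proof -
    have "(\<Sum>i\<in>X. min 1 (real (deg v {i}) / t) / 2) \<le> (\<Sum>i\<in>X. 1 - exp (- (real (deg v {i}) / t)))"
      using t by (intro sum_mono one_minus_exp_ge) simp
    also have "\<dots> \<le> (\<Sum>i\<in>{..<r} - S. 1 - exp (- (real (deg v {i}) / t)))"
      using that t by (intro sum_mono2) auto
    finally show ?thesis .
  qed
  show ?thesis
  proof (cases "2 * \<sigma> \<le> real (card L)")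
    case True
    have "(\<Sum>i\<in>L. min 1 (real (deg v {i}) / t) / 2) = (\<Sum>i\<in>L. 1 / 2)"
      using t by (intro sum.cong) (auto simp: L_def min_def field_simps)
    also have "\<dots> = real (card L) / 2" by simp
    finally have "real (card L) / 2 \<le> (\<Sum>i\<in>{..<r} - S. 1 - exp (- (real (deg v {i}) / t)))"
      using ge[OF L_sub] by linarith
    thus ?thesis using True by linarith
  next
    case False
    have "card (S \<union> L) \<le> card S + card L" by (rule card_Un_le)
    hence "card (S \<union> L) \<le> s" using False assms(3) by linarith
    hence "\<epsilon> * real n \<le> (\<Sum>i\<in>{..<r} - (S \<union> L). real (deg v {i}))"
      using assms(1,4) by (intro outside_mass) (auto simp: L_def)
    hence "\<epsilon> * real n / (2 * t) \<le> (\<Sum>i\<in>{..<r} - (S \<union> L). real (deg v {i})) / (2 * t)"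
      using t by (intro divide_right_mono) auto
    also have "\<dots> = (\<Sum>i\<in>{..<r} - (S \<union> L). min 1 (real (deg v {i}) / t) / 2)"
      unfolding sum_divide_distrib
      using t by (intro sum.cong) (auto simp: L_def min_def field_simps)
    also have "\<dots> \<le> (\<Sum>i\<in>{..<r} - S. 1 - exp (- (real (deg v {i}) / t)))"
      by (rule ge) auto
    \<comment> \<open>\<open>t\<close> is chosen so that \<open>\<epsilon> * n / (2 * t)\<close> is
      exactly \<open>\<sigma>\<close>.\<close>
    finally show ?thesis using eps n_pos assms(2) by (simp add: t_def field_simps)
  qed
qed

text \<open>A new colour \<open>i\<close> multiplies the term of \<open>v\<close> in the potential
  by \<open>exp (- (deg v {i} / t))\<close>. By \<open>weight_gain\<close> the relative losses at
  each vertex sum to at least \<open>\<sigma>\<close> over the colours, so some colour reduces the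
  potential by the factor \<open>1 - \<sigma> / r\<close>.\<close>

lemma greedy_colours:
  assumes "0 < \<sigma>" "\<sigma> \<le> real r" "real k + 2 * \<sigma> \<le> real s"
  defines "t \<equiv> \<epsilon> * real n / (2 * \<sigma>)"
  shows "\<exists>S\<subseteq>{..<r}. card S \<le> k \<and>
    (\<Sum>v<n. exp (- (real (deg v S) / t))) \<le> real n * (1 - \<sigma> / real r) ^ k"
  using assms(3)
proof (induction k)
  case 0
  show ?case by (intro exI[of _ "{}"]) (simp add: deg_def)
next
  case (Suc k)
  then obtain S where S: "S \<subseteq> {..<r}" "card S \<le> k"
    "(\<Sum>v<n. exp (- (real (deg v S) / t))) \<le> real n * (1 - \<sigma> / real r) ^ k" by auto
  have fS: "finite S" using finite_subset[OF S(1) finite_lessThan] .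
  define \<Psi> where "\<Psi> = (\<lambda>S. \<Sum>v<n. exp (- (real (deg v S) / t)))"
  have drop: "\<Psi> S - \<Psi> (insert i S) =
      (\<Sum>v<n. exp (- (real (deg v S) / t)) * (1 - exp (- (real (deg v {i}) / t))))" if "i \<notin> S" for i
  proof -
    have "deg v (insert i S) = deg v S + deg v {i}" for v
      using deg_sum[of "insert i S" v] deg_sum[of S v] fS that by simp
    thus ?thesis unfolding \<Psi>_def sum_subtractf[symmetric]
      by (intro sum.cong) (simp_all add: algebra_simps add_divide_distrib flip: exp_add)
  qed
  have "\<sigma> * \<Psi> S = (\<Sum>v<n. exp (- (real (deg v S) / t)) * \<sigma>)"
    by (simp add: \<Psi>_def sum_distrib_left mult.commute)
  also have "\<dots> \<le> (\<Sum>v<n. exp (- (real (deg v S) / t)) *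
      (\<Sum>i\<in>{..<r} - S. 1 - exp (- (real (deg v {i}) / t))))"
    unfolding t_def using S Suc.prems assms(1)
    by (intro sum_mono mult_left_mono weight_gain) auto
  also have "\<dots> = (\<Sum>i\<in>{..<r} - S. \<Psi> S - \<Psi> (insert i S))"
    unfolding sum_distrib_left by (subst sum.swap) (simp add: drop)
  \<comment> \<open>Colours already in \<open>S\<close> add zero terms, so the average may be taken
    over all \<open>r\<close> colours.\<close>
  also have "\<dots> = (\<Sum>i<r. \<Psi> S - \<Psi> (insert i S))"
    by (rule sum.mono_neutral_left) (auto simp: insert_absorb)
  finally obtain i where i: "i < r" "\<sigma> * \<Psi> S / real r \<le> \<Psi> S - \<Psi> (insert i S)"
    using exists_ge_average[OF r_pos] by blast
  have "\<Psi> (insert i S) \<le> (1 - \<sigma> / real r) * \<Psi> S" using i(2) by (simp add: algebra_simps)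
  also have "\<dots> \<le> (1 - \<sigma> / real r) * (real n * (1 - \<sigma> / real r) ^ k)"
    using S(3) assms(2) r_pos by (intro mult_left_mono) (auto simp: \<Psi>_def)
  finally have "\<Psi> (insert i S) \<le> real n * (1 - \<sigma> / real r) ^ Suc k" by (simp add: mult_ac)
  moreover have "card (insert i S) \<le> Suc k" using S(2) fS by (simp add: card_insert_if)
  ultimately show ?case using S(1) i(1) unfolding \<Psi>_def by (intro exI[of _ "insert i S"]) auto
qed

text \<open>Markov's inequality: a vertex of degree below \<open>t\<close> contributes at least
  \<open>exp (- 1)\<close> to the potential.\<close>

lemma card_high_degree:
  assumes "0 < t"
  shows "real n - exp 1 * (\<Sum>v<n. exp (- (real (deg v S) / t))) \<le> real (card {v. v < n \<and> t \<le> real (deg v S)})"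
proof -
  let ?V = "{v. v < n \<and> t \<le> real (deg v S)}"
  have "real n - real (card ?V) = real (card ({..<n} - ?V))"
  proof -
    have sub: "?V \<subseteq> {..<n}" by auto
    from card_mono[OF finite_lessThan this] card_Diff_subset[OF finite_subset[OF sub finite_lessThan] sub]
    show ?thesis by (simp add: of_nat_diff)
  qed
  also have "\<dots> = (\<Sum>v\<in>{..<n} - ?V. 1)" by simp
  also have "\<dots> \<le> (\<Sum>v\<in>{..<n} - ?V. exp 1 * exp (- (real (deg v S) / t)))"
    using assms by (intro sum_mono) (auto simp: field_simps simp flip: exp_add)
  also have "\<dots> \<le> (\<Sum>v<n. exp 1 * exp (- (real (deg v S) / t)))"
    by (intro sum_mono2) auto
  finally show ?thesis by (simp add: sum_distrib_left)
qed

text \<open>The components are disjoint, and each contains a vertex of \<open>V\<close> together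
  with its at least \<open>t\<close> neighbours.\<close>

lemma card_components_high_degree:
  assumes "V \<subseteq> {v. v < n \<and> t \<le> real (deg v S)}"
  shows "real (card (component n \<chi> S ` V)) * t \<le> real n"
proof -
  let ?Q = "component n \<chi> S ` V"
  have V: "V \<subseteq> {..<n}" using assms by auto
  have fin: "finite ?Q" using finite_subset[OF V finite_lessThan] by (rule finite_imageI)
  have disj: "D \<inter> D' = {}" if "D \<in> ?Q" "D' \<in> ?Q" "D \<noteq> D'" for D D'
    using that component_eq by blast
  have finD: "finite D" if "D \<in> ?Q" for D using that V finite_component by auto
  have "real (card ?Q) * t = (\<Sum>D\<in>?Q. t)" by simp
  also have "\<dots> \<le> (\<Sum>D\<in>?Q. real (card D))"
  proof (rule sum_mono)
    fix D assume "D \<in> ?Q"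
    then obtain v where v: "v \<in> V" "D = component n \<chi> S v" by blast
    hence "t \<le> real (deg v S)" "v < n" using assms by auto
    thus "t \<le> real (card D)" unfolding v(2) using deg_less_component[of v S] by linarith
  qed
  also have "\<dots> = real (card (\<Union>?Q))"
    using fin finD disj by (subst card_Union_disjoint) (auto simp: pairwise_def disjnt_def)
  also have "\<dots> \<le> real (card {..<n})"
  proof (intro of_nat_mono card_mono UN_least)
    fix v assume "v \<in> V"
    thus "component n \<chi> S v \<subseteq> {..<n}" using V by (intro component_subset) auto
  qed simp
  finally show ?thesis by simp
qed

section \<open>Merging the components that meet a large set of vertices\<close>

context
  fixes V :: "nat set"
  assumes V: "V \<subseteq> {..<n}" "(1 - \<epsilon>) * real n \<le> real (card V)"
begin

lemma not_covered:
  assumes "S \<subseteq> {..<r}" "card S \<le> s" "v < n"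
  shows "\<not> V \<subseteq> component n \<chi> S v"
proof
  assume "V \<subseteq> component n \<chi> S v"
  from card_mono[OF finite_component[OF assms(3)] this] show False
    using small[OF assms] V(2) by linarith
qed

text \<open>Otherwise the crossing colours alone would connect \<open>V\<close>, since the edges between the two sides
  of a cut form a complete bipartite graph.\<close>

lemma many_crossing_colours:
  assumes "X \<subseteq> V" "X \<noteq> {}" "X \<noteq> V"
  shows "s < card {\<chi> {x, y} |x y. x \<in> X \<and> y \<in> V - X}"
proof (rule ccontr)
  let ?C = "{\<chi> {x, y} |x y. x \<in> X \<and> y \<in> V - X}"
  assume "\<not> s < card ?C"
  moreover have sub: "?C \<subseteq> {..<r}"
  proof
    fix i assume "i \<in> ?C"
    then obtain x y where "x \<in> X" "y \<in> V - X" "i = \<chi> {x, y}" by blast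
    thus "i \<in> {..<r}" using V(1) assms(1) colour_less[OF colouring, of x y] by auto
  qed
  moreover obtain x y where xy: "x \<in> X" "y \<in> V - X" using assms by blast
  moreover have x: "x < n" using xy V assms by auto
  have edge: "b \<in> component n \<chi> ?C a" if "a \<in> X" "b \<in> V - X" for a b
    using that V(1) assms(1) by (intro component_edge) auto
  have "V \<subseteq> component n \<chi> ?C x"
  proof
    fix z assume z: "z \<in> V"
    show "z \<in> component n \<chi> ?C x"
    proof (cases "z \<in> X")
      case True
      thus ?thesis using edge[OF True xy(2)] edge[OF xy] component_trans component_sym by blast
    next
      case False
      thus ?thesis using edge[OF xy(1)] z by blast
    qed
  qed
  ultimately show False using not_covered[of ?C x] x by auto
qed

text \<open>At least \<open>s\<close> colours leave each component within \<open>V\<close>, so by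
  averaging some colour \<open>i\<close> leaves a share \<open>s / r\<close> of the components. Each
  of these merges with another one, and \<open>card_image_merged\<close> yields half that share as
  the loss.\<close>

lemma merge_step:
  assumes "S \<subseteq> {..<r}" "card S \<le> s"
  shows "\<exists>i<r. real (card (component n \<chi> (insert i S) ` V)) \<le>
    real (card (component n \<chi> S ` V)) * (1 - real s / (2 * real r))"
proof -
  define Q where "Q = component n \<chi> S ` V"
  define C where "C = (\<lambda>D. {\<chi> {x, y} |x y. x \<in> D \<inter> V \<and> y \<in> V - (D \<inter> V)})"
  have finQ: "finite Q" unfolding Q_def using finite_subset[OF V(1) finite_lessThan] by (rule finite_imageI)
  have C_sub: "C D \<subseteq> {..<r}" for D
  proof
    fix i assume "i \<in> C D"
    then obtain x y where "x \<in> D \<inter> V" "y \<in> V - (D \<inter> V)" "i = \<chi> {x, y}" unfolding C_def by blast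
    thus "i \<in> {..<r}" using V(1) colour_less[OF colouring, of x y] by auto
  qed
  have C_card: "s \<le> card (C D)" if D: "D \<in> Q" for D
  proof -
    obtain v where v: "v \<in> V" "D = component n \<chi> S v" using D unfolding Q_def by blast
    hence "\<not> V \<subseteq> D" using V(1) not_covered[OF assms] by auto
    moreover have "v \<in> D \<inter> V" using v component_self by auto
    ultimately show ?thesis unfolding C_def by (intro less_imp_le many_crossing_colours) auto
  qed
  have "real s * real (card Q) \<le> (\<Sum>D\<in>Q. real (card (C D)))"
    using sum_mono[of Q "\<lambda>_. real s" "\<lambda>D. real (card (C D))"] C_card by (simp add: mult.commute)
  also have "\<dots> = (\<Sum>D\<in>Q. \<Sum>i<r. if i \<in> C D then 1 else 0)"
    using C_sub by (intro sum.cong) (simp_all add: sum.If_cases Int_absorb1)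
  also have "\<dots> = (\<Sum>i<r. real (card {D\<in>Q. i \<in> C D}))"
    using finQ by (subst sum.swap) (simp add: sum.If_cases Int_def)
  finally obtain i where i: "i < r" "real s * real (card Q) / real r \<le> real (card {D\<in>Q. i \<in> C D})"
    using exists_ge_average[OF r_pos] by blast
  \<comment> \<open>\<open>h\<close> sends a component for \<open>S\<close> to the component for
    \<open>insert i S\<close> that contains it; the union avoids choosing a representative.\<close>
  define h where "h = (\<lambda>D. \<Union>x\<in>D. component n \<chi> (insert i S) x)"
  have h: "h (component n \<chi> S v) = component n \<chi> (insert i S) v" for v
  proof -
    have "component n \<chi> (insert i S) x = component n \<chi> (insert i S) v"
      if "x \<in> component n \<chi> S v" for x
      using that component_mono[of S "insert i S"] by (intro component_eq) blast
    hence "h (component n \<chi> S v) = (\<Union>x\<in>component n \<chi> S v. component n \<chi> (insert i S) v)"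
      unfolding h_def by simp
    thus ?thesis using component_self[of v n \<chi> S] by auto
  qed
  have "2 * card (h ` Q) + card {D\<in>Q. i \<in> C D} \<le> 2 * card Q"
  proof (rule card_image_merged[OF finQ])
    fix D assume "D \<in> {D\<in>Q. i \<in> C D}"
    then obtain v x y where D: "v \<in> V" "D = component n \<chi> S v" "x \<in> D" "x \<in> V" "y \<in> V" "y \<notin> D"
      "\<chi> {x, y} = i" unfolding Q_def C_def by blast
    have Dx: "D = component n \<chi> S x" using D(2) component_eq[of x n \<chi> S v] D(3) by simp
    have "y \<in> component n \<chi> (insert i S) x"
      using D V(1) by (intro component_edge) auto
    hence "h (component n \<chi> S y) = h D" unfolding Dx h by (rule component_eq)
    moreover have "component n \<chi> S y \<noteq> D" using D(6) component_self[of y n \<chi> S] by auto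
    moreover have "component n \<chi> S y \<in> Q" using D(5) by (simp add: Q_def)
    ultimately show "\<exists>D'\<in>Q. D' \<noteq> D \<and> h D' = h D" by blast
  qed auto
  moreover have "h ` Q = component n \<chi> (insert i S) ` V"
    unfolding Q_def image_image h ..
  ultimately have "2 * card (component n \<chi> (insert i S) ` V) + card {D\<in>Q. i \<in> C D} \<le> 2 * card Q"
    by simp
  hence "2 * real (card (component n \<chi> (insert i S) ` V)) + real (card {D\<in>Q. i \<in> C D})
      \<le> 2 * real (card Q)"
    by linarith
  moreover have "x \<le> y - z / 2" if "2 * x + u \<le> 2 * y" "z \<le> u" for x y z u :: real
    using that by linarith
  ultimately have "real (card (component n \<chi> (insert i S) ` V)) \<le>
      real (card Q) - real s * real (card Q) / real r / 2" using i(2) by blast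
  also have "\<dots> = real (card Q) * (1 - real s / (2 * real r))" by (simp add: algebra_simps)
  finally show ?thesis using i(1) unfolding Q_def by blast
qed

text \<open>While at most \<open>s\<close> colours are used, \<open>V\<close> meets at least two
  components; the induction carries this bound back through \<open>j\<close> rounds of
  \<open>merge_step\<close>.\<close>

lemma merge_steps:
  assumes "S \<subseteq> {..<r}" "card S + j \<le> s" "s \<le> r"
  shows "2 \<le> real (card (component n \<chi> S ` V)) * (1 - real s / (2 * real r)) ^ j"
  using assms(1,2)
proof (induction j arbitrary: S)
  case 0
  \<comment> \<open>\<open>small\<close> without colours at the vertex 0 shows that
    \<open>(1 - \<epsilon>) * n\<close> is positive.\<close>
  have "0 < real (card V)" using V(2) small[of "{}" 0] n_pos by auto
  hence "V \<noteq> {}" by auto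
  then obtain v where v: "v \<in> V" by blast
  hence "\<not> V \<subseteq> component n \<chi> S v" using V(1) not_covered[of S v] 0 by auto
  then obtain w where w: "w \<in> V" "w \<notin> component n \<chi> S v" by blast
  hence "component n \<chi> S w \<noteq> component n \<chi> S v" using component_self by blast
  moreover have "card {component n \<chi> S v, component n \<chi> S w} \<le> card (component n \<chi> S ` V)"
    using v w finite_subset[OF V(1) finite_lessThan] by (intro card_mono) auto
  ultimately show ?case by simp
next
  case (Suc j)
  obtain i where i: "i < r" "real (card (component n \<chi> (insert i S) ` V)) \<le>
    real (card (component n \<chi> S ` V)) * (1 - real s / (2 * real r))"
    using merge_step[OF Suc.prems(1)] Suc.prems(2) by auto
  have "card (insert i S) \<le> Suc (card S)" by (rule card_insert_le_m1) simp_all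
  hence "2 \<le> real (card (component n \<chi> (insert i S) ` V)) * (1 - real s / (2 * real r)) ^ j"
    using Suc.prems i(1) by (intro Suc.IH) auto
  also have "\<dots> \<le> (real (card (component n \<chi> S ` V)) * (1 - real s / (2 * real r))) * (1 - real s / (2 * real r)) ^ j"
    using i(2) assms(3) r_pos by (intro mult_right_mono) auto
  finally show ?case by (simp add: mult_ac)
qed

end

end

section \<open>Constants of the lower bound\<close>

lemma power_le_exp:
  fixes x :: real
  assumes "x \<le> 1" shows "(1 - x) ^ j \<le> exp (- (x * real j))"
proof -
  have "(1 - x) ^ j \<le> exp (- x) ^ j"
    using exp_ge_add_one_self[of "- x"] assms by (intro power_mono) auto
  thus ?thesis by (simp add: exp_of_nat_mult[symmetric] mult.commute)
qed

text \<open>At most \<open>s / 10\<close> colours go into the greedy choice and at least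
  \<open>9 / 10 * s\<close> into merging. Merging shrinks at most
  \<open>s / 5 * exp (L / 200)\<close> components by the factor \<open>exp (- (9 / 20 * L))\<close>,
  which leaves fewer than two when \<open>ln r \<le> 7 / 10 * L\<close>.\<close>

lemma f_lower_bound:
  fixes n r s :: nat
  defines "L \<equiv> (real s)\<^sup>2 / real r"
  assumes n: "0 < n" and sr: "s \<le> r" and L: "400 \<le> L" "ln (real r) \<le> 7 / 10 * L"
  shows "(1 - exp (- (L / 200))) * real n \<le> real (f n r s)"
proof -
  define \<epsilon> where "\<epsilon> = exp (- (L / 200))"
  have r: "0 < r" using L(1) by (cases "r = 0") (auto simp: L_def)
  have s: "0 < s" using L(1) by (cases "s = 0") (auto simp: L_def)
  have sL: "real s * real s / real r = L" by (simp add: L_def power2_eq_square)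
  have "\<exists>S v. S \<subseteq> {..<r} \<and> card S \<le> s \<and> v < n \<and> (1 - \<epsilon>) * real n \<le> real (card (component n \<chi> S v))"
    if "edge_colouring n r \<chi>" for \<chi>
  proof (rule ccontr)
    assume "\<not> ?thesis"
    then interpret small_components n r s \<chi> \<epsilon>
      using that n r by unfold_locales (auto simp: \<epsilon>_def not_le)
    define \<sigma> where "\<sigma> = real s / 10"
    define k where "k = s div 10"
    define t where "t = \<epsilon> * real n / (2 * \<sigma>)"
    have \<sigma>: "0 < \<sigma>" "\<sigma> \<le> real r" using s sr by (auto simp: \<sigma>_def)
    have k: "real k \<le> real s / 10" "real s / 10 - 1 \<le> real k" unfolding k_def by linarith+
    have t: "0 < t" using eps n \<sigma> by (simp add: t_def)
    obtain S where S: "S \<subseteq> {..<r}" "card S \<le> k"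
      "(\<Sum>v<n. exp (- (real (deg v S) / t))) \<le> real n * (1 - \<sigma> / real r) ^ k"
      using greedy_colours[of \<sigma> k] \<sigma> k(1) unfolding t_def by (auto simp: \<sigma>_def)
    define V where "V = {v. v < n \<and> t \<le> real (deg v S)}"
    have "(1 - \<sigma> / real r) ^ k \<le> exp (- (\<sigma> / real r * real k))"
      using \<sigma> r by (intro power_le_exp) auto
    \<comment> \<open>The summand \<open>1 / 10\<close> pays for rounding in \<open>k\<close>, since
      \<open>s \<le> r\<close>.\<close>
    also have "\<dots> \<le> exp (1 / 10 - L / 100)"
    proof -
      have "\<sigma> / real r * (real s / 10 - 1) \<le> \<sigma> / real r * real k"
        using k(2) \<sigma> by (intro mult_left_mono) auto
      moreover have "\<sigma> / real r * (real s / 10 - 1) = L / 100 - real s / real r / 10"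
        using r by (simp add: \<sigma>_def sL[symmetric] field_simps)
      moreover have "real s / real r \<le> 1" using sr r by simp
      moreover have "- x \<le> 1 / 10 - L / 100" if "y \<le> x" "y = L / 100 - z / 10" "z \<le> 1" for x y z :: real
        using that by linarith
      ultimately have "- (\<sigma> / real r * real k) \<le> 1 / 10 - L / 100" by blast
      thus ?thesis by simp
    qed
    finally have "exp 1 * (real n * (1 - \<sigma> / real r) ^ k) \<le> exp 1 * (real n * exp (1 / 10 - L / 100))"
      by (intro mult_left_mono) auto
    also have "\<dots> = real n * exp (11 / 10 - L / 100)" by (simp flip: exp_add)
    also have "\<dots> \<le> real n * \<epsilon>" using L(1) by (intro mult_left_mono) (auto simp: \<epsilon>_def)
    finally have "exp 1 * (\<Sum>v<n. exp (- (real (deg v S) / t))) \<le> real n * \<epsilon>"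
      by (rule order_trans[rotated]) (rule mult_left_mono[OF S(3)], simp)
    hence V: "V \<subseteq> {..<n}" "(1 - \<epsilon>) * real n \<le> real (card V)"
      using card_high_degree[OF t, of S] by (auto simp: V_def algebra_simps)
    have "real (card (component n \<chi> S ` V)) * t \<le> real n"
      by (rule card_components_high_degree) (simp add: V_def)
    hence c0: "real (card (component n \<chi> S ` V)) \<le> real s / 5 * exp (L / 200)"
      using eps n \<sigma>(1) s by (simp add: t_def \<sigma>_def \<epsilon>_def exp_minus field_simps)
    have "(1 - real s / (2 * real r)) ^ (s - k) \<le> exp (- (real s / (2 * real r) * real (s - k)))"
      using sr r by (intro power_le_exp) auto
    also have "\<dots> \<le> exp (- (9 / 20 * L))"
    proof -
      have "real s / (2 * real r) * (9 / 10 * real s) \<le> real s / (2 * real r) * real (s - k)"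
        using k(1) by (intro mult_left_mono) (auto simp: of_nat_diff)
      moreover have "real s / (2 * real r) * (9 / 10 * real s) = 9 / 20 * L"
        using r by (simp add: sL[symmetric] field_simps)
      ultimately show ?thesis by (simp only: exp_le_cancel_iff neg_le_iff_le)
    qed
    finally have decay: "(1 - real s / (2 * real r)) ^ (s - k) \<le> exp (- (9 / 20 * L))" .
    have "2 \<le> real (card (component n \<chi> S ` V)) * (1 - real s / (2 * real r)) ^ (s - k)"
      using S k(1) sr by (intro merge_steps V) auto
    also have "\<dots> \<le> (real s / 5 * exp (L / 200)) * exp (- (9 / 20 * L))"
      using sr r by (intro mult_mono c0 decay) auto
    also have "\<dots> = real s / 5 * exp (- (89 / 200 * L))" by (simp flip: exp_add)
    \<comment> \<open>Squaring replaces the square of \<open>s\<close> by \<open>L * r\<close>, so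
      \<open>r\<close> enters only to the first power and \<open>7 / 10\<close> needs to beat merely
      \<open>89 / 100\<close>.\<close>
    finally have "2\<^sup>2 \<le> (real s / 5 * exp (- (89 / 200 * L)))\<^sup>2" by (intro power_mono) auto
    also have "\<dots> = (real s)\<^sup>2 / 25 * exp (- (89 / 100 * L))"
      by (simp add: power_mult_distrib power_divide flip: exp_double)
    also have "(real s)\<^sup>2 = L * exp (ln (real r))" using r by (simp add: L_def)
    also have "L * exp (ln (real r)) / 25 * exp (- (89 / 100 * L)) = L / 25 * exp (ln (real r) - 89 / 100 * L)"
      by (simp only: diff_conv_add_uminus exp_add times_divide_eq_left mult.assoc)
    also have "\<dots> \<le> L / 25 * exp (- (19 / 100 * L))" using L by (intro mult_left_mono) auto
    finally have "4 * exp (19 / 100 * L) \<le> L / 25" by (simp add: exp_minus field_simps)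
    thus False using exp_ge_add_one_self[of "19 / 100 * L"] L(1) by linarith
  qed
  from f_ge[OF n r this] show ?thesis by (simp add: \<epsilon>_def)
qed

section \<open>The upper bound\<close>

lemma card_double_count:
  fixes P :: "'a \<Rightarrow> 'b \<Rightarrow> bool"
  assumes "finite A" "finite B"
  shows "(\<Sum>x\<in>A. card {y\<in>B. P x y}) = (\<Sum>y\<in>B. card {x\<in>A. P x y})"
proof -
  have "(\<Sum>x\<in>A. card {y\<in>B. P x y}) = (\<Sum>x\<in>A. \<Sum>y\<in>B. if P x y then 1 else 0)"
    using assms by (intro sum.cong) (simp_all add: sum.If_cases Int_def)
  also have "\<dots> = (\<Sum>y\<in>B. card {x\<in>A. P x y})"
    using assms by (subst sum.swap) (simp add: sum.If_cases Int_def)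
  finally show ?thesis .
qed

text \<open>Each chosen element conflicts with at most a share \<open>\<delta>\<close> of
  \<open>G\<close>, so in every round at least a share \<open>q / 2\<close> of \<open>G\<close> is
  compatible with the choices and misses a given remaining \<open>S\<close>. By averaging, one
  compatible \<open>g\<close> misses a share \<open>q / 2\<close> of the remaining sets.\<close>

lemma greedy_family:
  fixes miss :: "'a \<Rightarrow> 'b \<Rightarrow> bool" and conf :: "'a \<Rightarrow> 'a \<Rightarrow> bool" and q \<delta> :: real
  assumes fin: "finite G" "G \<noteq> {}" "finite U"
    and sym: "\<And>g h. conf g h \<Longrightarrow> conf h g"
    and miss: "\<And>S. S \<in> U \<Longrightarrow> q * real (card G) \<le> real (card {g\<in>G. miss g S})"
    and conf: "\<And>h. h \<in> G \<Longrightarrow> real (card {g\<in>G. conf h g}) \<le> \<delta> * real (card G)"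
    and q: "0 < q" "q \<le> 1" and \<delta>: "0 \<le> \<delta>" "real j * \<delta> \<le> q / 2"
  shows "\<exists>A\<subseteq>G. card A \<le> j \<and> (\<forall>g\<in>A. \<forall>h\<in>A. g \<noteq> h \<longrightarrow> \<not> conf g h) \<and>
    real (card {S\<in>U. \<forall>g\<in>A. \<not> miss g S}) \<le> (1 - q / 2) ^ j * real (card U)"
  using \<delta>(2)
proof (induction j)
  case 0
  show ?case by (intro exI[of _ "{}"]) simp
next
  case (Suc j)
  have "real j * \<delta> \<le> real (Suc j) * \<delta>" using \<delta>(1) by (intro mult_right_mono) auto
  then obtain A where A: "A \<subseteq> G" "card A \<le> j" "\<forall>g\<in>A. \<forall>h\<in>A. g \<noteq> h \<longrightarrow> \<not> conf g h"
    "real (card {S\<in>U. \<forall>g\<in>A. \<not> miss g S}) \<le> (1 - q / 2) ^ j * real (card U)"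
    using Suc by (meson order_trans)
  have finA: "finite A" using finite_subset[OF A(1) fin(1)] .
  have q2: "0 \<le> 1 - q / 2" using q by simp
  define U' where "U' = {S\<in>U. \<forall>g\<in>A. \<not> miss g S}"
  define G' where "G' = {g\<in>G. \<forall>h\<in>A. \<not> conf h g}"
  have finU': "finite U'" and finG': "finite G'" using fin by (auto simp: U'_def G'_def)
  show ?case
  proof (cases "U' = {}")
    case True
    \<comment> \<open>Every set in \<open>U\<close> is missed already, so \<open>A\<close> is kept
      unchanged.\<close>
    have "real (card {S\<in>U. \<forall>g\<in>A. \<not> miss g S}) = 0" 
      using True unfolding U'_def by (simp only: card.empty of_nat_0)
    also have "0 \<le> (1 - q / 2) ^ Suc j * real (card U)" using q2 by simp
    finally show ?thesis using A(1-3) le_SucI by blast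
  next
    case False
    have conf_A: "real (card {g\<in>G. \<exists>h\<in>A. conf h g}) \<le> q / 2 * real (card G)"
    proof -
      have "{g\<in>G. \<exists>h\<in>A. conf h g} = (\<Union>h\<in>A. {g\<in>G. conf h g})" by auto
      hence "real (card {g\<in>G. \<exists>h\<in>A. conf h g}) \<le> (\<Sum>h\<in>A. real (card {g\<in>G. conf h g}))"
        using card_UN_le[OF finA, of "\<lambda>h. {g\<in>G. conf h g}"] by (simp flip: of_nat_sum)
      also have "\<dots> \<le> (\<Sum>h\<in>A. \<delta> * real (card G))" using A(1) by (intro sum_mono conf) auto
      also have "\<dots> = real (card A) * \<delta> * real (card G)" by simp
      also have "\<dots> \<le> q / 2 * real (card G)"
      proof (intro mult_right_mono)
        have "real (card A) * \<delta> \<le> real (Suc j) * \<delta>" using A(2) \<delta>(1) by (intro mult_right_mono) auto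
        thus "real (card A) * \<delta> \<le> q / 2" using Suc.prems by linarith
      qed simp
      finally show ?thesis .
    qed
    have miss': "q / 2 * real (card G) \<le> real (card {g\<in>G'. miss g S})" if "S \<in> U'" for S
    proof -
      have "{g\<in>G. miss g S} \<subseteq> {g\<in>G'. miss g S} \<union> {g\<in>G. \<exists>h\<in>A. conf h g}"
        by (auto simp: G'_def)
      hence "card {g\<in>G. miss g S} \<le> card ({g\<in>G'. miss g S} \<union> {g\<in>G. \<exists>h\<in>A. conf h g})"
        using fin finG' by (intro card_mono) auto
      also have "\<dots> \<le> card {g\<in>G'. miss g S} + card {g\<in>G. \<exists>h\<in>A. conf h g}" by (rule card_Un_le)
      finally show ?thesis using miss[of S] that conf_A by (simp add: U'_def)
    qed
    have "\<exists>g\<in>G'. q / 2 * real (card U') \<le> real (card {S\<in>U'. miss g S})"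
    proof (rule ccontr)
      assume neg: "\<not> ?thesis"
      have pos: "0 < q / 2 * real (card G)" using q fin by (simp add: card_gt_0_iff)
      \<comment> \<open>The strict inequality of sums requires \<open>G'\<close> to be nonempty,
        which any remaining \<open>S\<close> ensures.\<close>
      obtain S where "S \<in> U'" using False by blast
      with miss'[of S] pos have "0 < card {g\<in>G'. miss g S}" by linarith
      hence "G' \<noteq> {}" by (auto simp: card_gt_0_iff)
      hence "(\<Sum>g\<in>G'. real (card {S\<in>U'. miss g S})) < (\<Sum>g\<in>G'. q / 2 * real (card U'))"
        using neg finG' by (intro sum_strict_mono) (auto simp: not_le)
      also have "\<dots> = real (card G') * (q / 2 * real (card U'))" by simp
      also have "\<dots> \<le> real (card G) * (q / 2 * real (card U'))"
        using fin q by (intro mult_right_mono of_nat_mono card_mono) (auto simp: G'_def)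
      also have "\<dots> = (\<Sum>S\<in>U'. q / 2 * real (card G))" by simp
      also have "\<dots> \<le> (\<Sum>S\<in>U'. real (card {g\<in>G'. miss g S}))" by (intro sum_mono miss')
      also have "\<dots> = (\<Sum>g\<in>G'. real (card {S\<in>U'. miss g S}))"
        using card_double_count[OF finG' finU', of miss] by (simp flip: of_nat_sum)
      finally show False by simp
    qed
    then obtain g where g: "g \<in> G'" "q / 2 * real (card U') \<le> real (card {S\<in>U'. miss g S})" by blast
    have split: "{S\<in>U. \<forall>h\<in>insert g A. \<not> miss h S} = U' - {S\<in>U'. miss g S}"
      by (auto simp: U'_def)
    have "card {S\<in>U'. miss g S} \<le> card U'" using finU' by (intro card_mono) auto
    hence "real (card {S\<in>U. \<forall>h\<in>insert g A. \<not> miss h S}) = real (card U') - real (card {S\<in>U'. miss g S})"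
      unfolding split using finU' by (subst card_Diff_subset) (auto simp: of_nat_diff)
    also have "\<dots> \<le> (1 - q / 2) * real (card U')" using g(2) by (simp add: algebra_simps)
    also have "\<dots> \<le> (1 - q / 2) * ((1 - q / 2) ^ j * real (card U))"
      using A(4) q2 unfolding U'_def by (rule mult_left_mono)
    finally have "real (card {S\<in>U. \<forall>h\<in>insert g A. \<not> miss h S}) \<le> (1 - q / 2) ^ Suc j * real (card U)"
      by simp
    moreover have "card (insert g A) \<le> Suc j" using A(2) finA by (simp add: card_insert_if)
    moreover have "\<forall>x\<in>insert g A. \<forall>y\<in>insert g A. x \<noteq> y \<longrightarrow> \<not> conf x y"
      using A(3) g(1) sym by (auto simp: G'_def)
    moreover have "insert g A \<subseteq> G" using A(1) g(1) by (auto simp: G'_def)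
    ultimately show ?thesis by blast
  qed
qed

section \<open>Ratios of binomial coefficients\<close>

lemma Suc_times_binomial_Suc: "Suc k * (a choose Suc k) = (a - k) * (a choose k)"
  using binomial_absorption[of k a] binomial_absorb_comp[of a k] by simp

lemma binomial_ratio_le:
  assumes "a \<le> b" "0 < b"
  shows "real (a choose k) \<le> (real a / real b) ^ k * real (b choose k)"
proof (induction k)
  case (Suc k)
  have "real (a - k) \<le> real a / real b * real (b - k)"
  proof (cases "k \<le> a")
    case True
    have "real k * real a \<le> real k * real b" using assms by (intro mult_left_mono) auto
    thus ?thesis using True assms by (simp add: of_nat_diff field_simps)
  qed simp
  hence "real (a - k) * real (a choose k) \<le>
      (real a / real b * real (b - k)) * ((real a / real b) ^ k * real (b choose k))"
    using Suc by (intro mult_mono) auto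
  also have "\<dots> = (real a / real b) ^ Suc k * (real (b - k) * real (b choose k))" by simp
  also have "real (b - k) * real (b choose k) = real (Suc k) * real (b choose Suc k)"
    using Suc_times_binomial_Suc[of k b] by (metis of_nat_mult)
  also have "real (a - k) * real (a choose k) = real (Suc k) * real (a choose Suc k)"
    using Suc_times_binomial_Suc[of k a] by (metis of_nat_mult)
  finally have "real (Suc k) * real (a choose Suc k) \<le>
      real (Suc k) * ((real a / real b) ^ Suc k * real (b choose Suc k))" by (simp only: mult_ac)
  thus ?case by (rule mult_left_le_imp_le) simp
qed simp

lemma binomial_ratio_ge:
  assumes "0 \<le> x" "\<And>i. i < k \<Longrightarrow> x * real (b - i) \<le> real (a - i)"
  shows "x ^ k * real (b choose k) \<le> real (a choose k)"
  using assms(2)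
proof (induction k)
  case (Suc k)
  have "real (Suc k) * (x ^ Suc k * real (b choose Suc k)) =
      x ^ Suc k * (real (b - k) * real (b choose k))"
    using Suc_times_binomial_Suc[of k b] by (metis of_nat_mult mult.left_commute)
  also have "\<dots> = (x * real (b - k)) * (x ^ k * real (b choose k))" by simp
  also have "\<dots> \<le> real (a - k) * real (a choose k)"
    using Suc assms(1) by (intro mult_mono) auto
  also have "\<dots> = real (Suc k) * real (a choose Suc k)"
    using Suc_times_binomial_Suc[of k a] by (metis of_nat_mult)
  finally show ?case by (rule mult_left_le_imp_le) simp
qed simp

section \<open>Palettes and the colouring they define\<close>

lemma card_palettes_avoiding:
  assumes "S \<subseteq> {..<r}"
  shows "card {P \<in> {P. P \<subseteq> {..<r} \<and> card P = k}. P \<inter> S = {}} = (r - card S) choose k"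
proof -
  have fS: "finite S" using finite_subset[OF assms finite_lessThan] .
  have "{P \<in> {P. P \<subseteq> {..<r} \<and> card P = k}. P \<inter> S = {}} = {P. P \<subseteq> {..<r} - S \<and> card P = k}" by auto
  thus ?thesis using n_subsets[of "{..<r} - S" k] card_Diff_subset[OF fS assms] by simp
qed

text \<open>\<open>greedy_family\<close> is applied to the \<open>k\<close>-subsets, with
  disjointness as conflict. There are at most \<open>2 ^ r\<close> sets \<open>S\<close>, so after
  \<open>M\<close> rounds less than one remains, hence none.\<close>

lemma palette_family:
  fixes r s k M :: nat and q \<delta> :: real
  assumes "0 < k" "k \<le> r"
    and q: "0 < q" "q \<le> 1" and M: "real M * \<delta> \<le> q / 2" "(1 - q / 2) ^ M * 2 ^ r < 1"
    and \<delta>: "(1 - real k / real r) ^ k \<le> \<delta>"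
    and miss: "\<And>t. t \<le> s \<Longrightarrow> q * real (r choose k) \<le> real ((r - t) choose k)"
  obtains A where "finite A" "card A \<le> M" "\<And>P. P \<in> A \<Longrightarrow> P \<subseteq> {..<r}"
    "\<And>P Q. P \<in> A \<Longrightarrow> Q \<in> A \<Longrightarrow> P \<inter> Q \<noteq> {}"
    "\<And>S. S \<subseteq> {..<r} \<Longrightarrow> card S \<le> s \<Longrightarrow> \<exists>P\<in>A. P \<inter> S = {}"
proof -
  define G where "G = {P. P \<subseteq> {..<r} \<and> card P = k}"
  define U where "U = {S. S \<subseteq> {..<r} \<and> card S \<le> s}"
  have finG: "finite G" and finU: "finite U"
    unfolding G_def U_def by (rule finite_subset[of _ "Pow {..<r}"]; auto)+
  have cardG: "card G = r choose k" unfolding G_def by (simp add: n_subsets)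
  have cardU: "card U \<le> 2 ^ r"
    using card_mono[of "Pow {..<r}" U] by (auto simp: U_def card_Pow)
  have "0 \<le> (1 - real k / real r) ^ k" using assms(1,2) by simp
  hence \<delta>0: "0 \<le> \<delta>" using \<delta> by linarith
  have G0: "G \<noteq> {}" using cardG assms(2) finG by (metis card.empty zero_less_binomial less_irrefl)
  have missU: "q * real (card G) \<le> real (card {g\<in>G. g \<inter> S = {}})" if "S \<in> U" for S
    using that miss[of "card S"] card_palettes_avoiding[of S r k] by (simp add: U_def cardG) (simp add: G_def)
  have confG: "real (card {g\<in>G. h \<inter> g = {}}) \<le> \<delta> * real (card G)" if "h \<in> G" for h
  proof -
    have "real (card {g\<in>G. h \<inter> g = {}}) = real ((r - k) choose k)"
      using that card_palettes_avoiding[of h r k] by (simp add: G_def Int_commute)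
    also have "\<dots> \<le> (real (r - k) / real r) ^ k * real (r choose k)"
      using assms(1,2) by (intro binomial_ratio_le) auto
    also have "real (r - k) / real r = 1 - real k / real r"
      using assms(1,2) by (simp add: of_nat_diff field_simps)
    also have "(1 - real k / real r) ^ k * real (r choose k) \<le> \<delta> * real (r choose k)"
      using \<delta> by (intro mult_right_mono) auto
    finally show ?thesis by (simp add: cardG)
  qed
  obtain A where A: "A \<subseteq> G" "card A \<le> M" "\<forall>g\<in>A. \<forall>h\<in>A. g \<noteq> h \<longrightarrow> g \<inter> h \<noteq> {}"
    "real (card {S\<in>U. \<forall>g\<in>A. \<not> g \<inter> S = {}}) \<le> (1 - q / 2) ^ M * real (card U)"
    using greedy_family[of G U "\<lambda>g h. g \<inter> h = {}" q "\<lambda>g S. g \<inter> S = {}" \<delta> M]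
      finG G0 finU missU confG q \<delta>0 M(1) by (auto simp: Int_commute)
  have "(1 - q / 2) ^ M * real (card U) \<le> (1 - q / 2) ^ M * 2 ^ r"
    using q cardU by (intro mult_left_mono) (auto simp: numeral_power_le_of_nat_cancel_iff of_nat_le_numeral_power_cancel_iff)
  hence "card {S\<in>U. \<forall>g\<in>A. \<not> g \<inter> S = {}} = 0" using A(4) M(2) by linarith
  hence none: "{S\<in>U. \<forall>g\<in>A. \<not> g \<inter> S = {}} = {}" using finU by simp
  show thesis
  proof (rule that[of A])
    show "finite A" using finite_subset[OF A(1) finG] .
    show "card A \<le> M" by fact
    show "P \<subseteq> {..<r}" if "P \<in> A" for P using that A(1) by (auto simp: G_def)
    show "P \<inter> Q \<noteq> {}" if "P \<in> A" "Q \<in> A" for P Q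
    proof (cases "P = Q")
      case True
      \<comment> \<open>\<open>greedy_family\<close> compares distinct palettes only; a palette
        meets itself because \<open>k\<close> is positive.\<close>
      have "card P = k" using that A(1) by (auto simp: G_def)
      thus ?thesis using True assms(1) by auto
    next
      case False
      thus ?thesis using that A(3) by blast
    qed
    show "\<exists>P\<in>A. P \<inter> S = {}" if "S \<subseteq> {..<r}" "card S \<le> s" for S
      using that none by (auto simp: U_def)
  qed
qed

lemma card_residue_class:
  assumes "j < a" shows "n div a \<le> card {v. v < n \<and> v mod a = j}"
proof -
  have "inj_on (\<lambda>i. i * a + j) {..<n div a}"
    using assms by (auto simp: inj_on_def)
  moreover have "(\<lambda>i. i * a + j) ` {..<n div a} \<subseteq> {v. v < n \<and> v mod a = j}"
  proof (clarsimp simp: assms)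
    fix i assume "i < n div a"
    hence "(i + 1) * a \<le> n div a * a" by (intro mult_right_mono) auto
    also have "\<dots> \<le> n" by simp
    finally show "i * a + j < n" using assms by simp
  qed
  ultimately show ?thesis
    using card_inj_on_le[of "\<lambda>i. i * a + j" "{..<n div a}" "{v. v < n \<and> v mod a = j}"] by simp
qed

text \<open>If the palette \<open>P\<close> avoids \<open>S\<close>, all vertices of palette \<open>P\<close> are isolated
  in the graph of the colours in \<open>S\<close>.\<close>

lemma palette_bound:
  assumes "finite A" "0 < n" "0 < r"
    and sub: "\<And>P. P \<in> A \<Longrightarrow> P \<subseteq> {..<r}"
    and meet: "\<And>P Q. P \<in> A \<Longrightarrow> Q \<in> A \<Longrightarrow> P \<inter> Q \<noteq> {}"
    and miss: "\<And>S. S \<subseteq> {..<r} \<Longrightarrow> card S \<le> s \<Longrightarrow> \<exists>P\<in>A. P \<inter> S = {}"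
  shows "f n r s \<le> max 1 (n - n div card A)"
proof -
  define a where "a = card A"
  have "A \<noteq> {}" using miss[of "{}"] by auto
  hence a: "0 < a" using assms(1) by (simp add: a_def card_gt_0_iff)
  obtain pal where pal: "bij_betw pal {..<a} A"
    using ex_bij_betw_nat_finite[OF assms(1)] by (auto simp: a_def atLeast0LessThan)
  define \<phi> where "\<phi> v = pal (v mod a)" for v
  have \<phi>: "\<phi> v \<in> A" for v using pal a by (auto simp: \<phi>_def bij_betw_def)
  \<comment> \<open>A common colour of the palettes exists because they meet; vertices of one
    residue class share a palette, so \<open>meet\<close> is also needed for
    \<open>P = Q\<close>.\<close>
  define \<chi> where "\<chi> e = (SOME i. \<forall>v\<in>e. i \<in> \<phi> v)" for e
  have \<chi>: "\<chi> {u, v} \<in> \<phi> u" "\<chi> {u, v} \<in> \<phi> v" for u v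
  proof -
    have "\<exists>i. \<forall>w\<in>{u, v}. i \<in> \<phi> w" using meet[OF \<phi> \<phi>, of u v] by auto
    from someI_ex[OF this] show "\<chi> {u, v} \<in> \<phi> u" "\<chi> {u, v} \<in> \<phi> v" by (auto simp: \<chi>_def)
  qed
  have "edge_colouring n r \<chi>"
    using \<chi> sub[OF \<phi>] by (fastforce simp: edge_colouring_def complete_edges_def card_2_iff)
  then obtain S W F where W: "S \<subseteq> {..<r}" "card S \<le> s" "subgraph_of_complete n W F"
    "connected_graph W F" "f n r s \<le> card W" "\<forall>e\<in>F. \<chi> e \<in> S"
    using f_greatest(1)[OF assms(2,3), of s] by blast
  obtain P where P: "P \<in> A" "P \<inter> S = {}" using miss[OF W(1,2)] by blast
  then obtain j where j: "j < a" "pal j = P" using pal by (auto simp: bij_betw_def)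
  define B where "B = {v. v < n \<and> v mod a = j}"
  have Wn: "W \<subseteq> {..<n}" using W(3) by (simp add: subgraph_of_complete_def)
  have isolated: "{v, w} \<notin> F" if "v \<in> B" for v w
    using \<chi>(1)[of v w] W(6) P(2) that j(2) by (auto simp: \<phi>_def B_def)
  show ?thesis
  proof (cases "W \<inter> B = {}")
    case True
    hence "card W \<le> card ({..<n} - B)" using Wn by (intro card_mono) auto
    also have "\<dots> = n - card B" by (subst card_Diff_subset) (auto simp: B_def)
    also have "\<dots> \<le> n - n div a" using card_residue_class[OF j(1), of n] by (simp add: B_def)
    finally show ?thesis using W(5) by (simp add: a_def)
  next
    case False
    then obtain v where v: "v \<in> W" "v \<in> B" by blast
    have "w = v" if "w \<in> W" for w
    proof -
      have "(v, w) \<in> {(x, y). {x, y} \<in> F}\<^sup>*" using W(4) v that by (simp add: connected_graph_def)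
      thus ?thesis by (cases rule: converse_rtranclE) (use isolated[OF v(2)] in auto)
    qed
    hence "W = {v}" using v by blast
    thus ?thesis using W(5) by simp
  qed
qed

lemma f_upper_bound:
  fixes n r s :: nat
  defines "L \<equiv> (real s)\<^sup>2 / real r"
  assumes sr: "20 * s \<le> r" and L: "1 \<le> L" "ln (real r) \<le> L"
    and n: "2 * exp (43 * real r) \<le> real n"
  shows "real (f n r s) \<le> (1 - exp (- (44 * L))) * real n"
proof -
  have r: "0 < r" using L(1) by (cases "r = 0") (auto simp: L_def)
  have s: "0 < s" using L(1) by (cases "s = 0") (auto simp: L_def)
  have sL: "real s * real s / real r = L" by (simp add: L_def power2_eq_square)
  define k where "k = 10 * s"
  define q where "q = exp (- (40 * L))"
  define M where "M = nat \<lceil>2 * real r * exp (40 * L)\<rceil>"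
  have r_le: "real r \<le> exp L" using L(2) r by (metis exp_le_cancel_iff exp_ln of_nat_0_less_iff)
  have M_ge: "2 * real r * exp (40 * L) \<le> real M" unfolding M_def by linarith
  have M_le: "real M \<le> exp (43 * L)"
  proof -
    have "0 \<le> 2 * real r * exp (40 * L)" by simp
    hence "real M \<le> 2 * real r * exp (40 * L) + 1" unfolding M_def by linarith
    also have "\<dots> \<le> 2 * exp L * exp (40 * L) + exp (41 * L)"
      using r_le L(1) by (intro add_mono mult_mono) auto
    also have "\<dots> = 3 * exp (41 * L)" by (simp flip: exp_add)
    also have "\<dots> \<le> exp (2 * L) * exp (41 * L)"
      using order_trans[OF _ exp_ge_add_one_self[of "2 * L"], of 3] L(1)
      by (intro mult_right_mono) auto
    finally show ?thesis by (simp flip: exp_add)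
  qed
  obtain A where A: "finite A" "card A \<le> M" "\<And>P. P \<in> A \<Longrightarrow> P \<subseteq> {..<r}"
    "\<And>P Q. P \<in> A \<Longrightarrow> Q \<in> A \<Longrightarrow> P \<inter> Q \<noteq> {}"
    "\<And>S. S \<subseteq> {..<r} \<Longrightarrow> card S \<le> s \<Longrightarrow> \<exists>P\<in>A. P \<inter> S = {}"
  proof (rule palette_family[of k r q M "exp (- (100 * L))" s])
    show "0 < k" "k \<le> r" using s sr by (auto simp: k_def)
    show "0 < q" "q \<le> 1" using L(1) by (auto simp: q_def)
    have "real M * exp (- (100 * L)) \<le> exp (43 * L) * exp (- (100 * L))"
      using M_le by (intro mult_right_mono) auto
    also have "\<dots> = q * exp (- (17 * L))" by (simp add: q_def flip: exp_add)
    also have "\<dots> \<le> q * (1 / 2)"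
      using order_trans[OF _ exp_ge_add_one_self[of "17 * L"], of 2] L(1)
      by (intro mult_left_mono) (auto simp: exp_minus field_simps q_def)
    finally show "real M * exp (- (100 * L)) \<le> q / 2" by simp
    have "(1 - q / 2) ^ M \<le> exp (- (q / 2 * real M))"
      using L(1) by (intro power_le_exp) (simp add: q_def, smt (verit) exp_le_one_iff)
    also have "\<dots> \<le> exp (- real r)"
      using M_ge by (simp add: q_def exp_minus field_simps)
    also have "\<dots> = exp (- 1) ^ r" by (simp flip: exp_of_nat_mult)
    finally have "(1 - q / 2) ^ M * 2 ^ r \<le> (2 * exp (- 1)) ^ r"
      by (simp add: power_mult_distrib)
    also have "\<dots> < 1"
      using exp_lower_Taylor_quadratic[of 1] r
      by (intro power_less_one_iff[THEN iffD2]) (auto simp: exp_minus field_simps)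
    finally show "(1 - q / 2) ^ M * 2 ^ r < 1" .
    have "(1 - real k / real r) ^ k \<le> exp (- (real k / real r * real k))"
      using r sr by (intro power_le_exp) (auto simp: k_def)
    also have "real k / real r * real k = 100 * L" using r by (simp add: sL[symmetric] k_def field_simps)
    finally show "(1 - real k / real r) ^ k \<le> exp (- (100 * L))" .
    fix t assume t: "t \<le> s"
    define y where "y = 2 * real s / real r"
    have y: "0 \<le> y" "y \<le> 1 / 2" using sr r by (auto simp: y_def field_simps)
    have "exp (- (2 * y)) \<le> 1 / (1 + 2 * y)"
      using exp_ge_add_one_self[of "2 * y"] y by (simp add: exp_minus field_simps)
    also have "\<dots> \<le> 1 - y"
    proof -
      have "0 \<le> y * (1 - 2 * y)" using y by (intro mult_nonneg_nonneg) auto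
      thus ?thesis using y by (simp add: field_simps)
    qed
    finally have "exp (- (2 * y)) ^ k \<le> (1 - y) ^ k" by (intro power_mono) auto
    moreover have "exp (- (2 * y)) ^ k = q"
      using r by (simp add: sL[symmetric] q_def y_def k_def field_simps flip: exp_of_nat_mult)
    ultimately have "q * real (r choose k) \<le> (1 - y) ^ k * real (r choose k)"
      by (intro mult_right_mono) auto
    also have "\<dots> \<le> real ((r - t) choose k)"
    proof (rule binomial_ratio_ge)
      show "0 \<le> 1 - y" using y by simp
      fix i assume "i < k"
      hence i: "t + i \<le> r" "2 * i \<le> r" using t sr by (auto simp: k_def)
      have "real s = y * (real r / 2)" using r by (simp add: y_def)
      also have "\<dots> \<le> y * (real r - real i)" using i y by (intro mult_left_mono) auto
      finally show "(1 - y) * real (r - i) \<le> real (r - t - i)"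
        using i t by (simp add: of_nat_diff algebra_simps)
    qed
    finally show "q * real (r choose k) \<le> real ((r - t) choose k)" .
  qed (rule that)
  define a where "a = card A"
  have "A \<noteq> {}" using A(5)[of "{}"] by auto
  hence a: "0 < a" using A(1) by (simp add: a_def card_gt_0_iff)
  have a_le: "real a \<le> exp (43 * L)" using A(2) M_le unfolding a_def by linarith
  have "L \<le> real s" using sL s r sr by (auto simp: field_simps L_def power2_eq_square)
  hence "L \<le> real r" using sr by simp
  hence "2 * exp (43 * L) \<le> real n" using n exp_le_cancel_iff[of "43 * L" "43 * real r"] by linarith
  hence n2: "2 * real a \<le> real n" using a_le by linarith
  have npos: "0 < n" using n2 a by linarith
  have half: "exp (- L) \<le> 1 / 2"
    using order_trans[OF _ exp_ge_add_one_self[of L], of 2] L(1) by (simp add: exp_minus field_simps)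
  have "real n < real a + real (n div a) * real a"
    using dividend_less_div_times[OF a, of n] by (metis of_nat_add of_nat_less_iff of_nat_mult)
  hence "real n / 2 < real (n div a) * real a" using n2 by linarith
  also have "\<dots> \<le> real (n div a) * exp (43 * L)" using a_le by (intro mult_left_mono) auto
  finally have "exp (- (43 * L)) * (1 / 2) * real n \<le> real (n div a)"
    by (simp add: exp_minus field_simps)
  moreover have "exp (- (43 * L)) * exp (- L) * real n \<le> exp (- (43 * L)) * (1 / 2) * real n"
    using half by (intro mult_right_mono mult_left_mono) auto
  ultimately have loss: "exp (- (44 * L)) * real n \<le> real (n div a)"
    by (simp flip: exp_add)
  have "exp (- (44 * L)) \<le> exp (- L)" using L(1) by simp
  hence "1 / 2 \<le> 1 - exp (- (44 * L))" using half by linarith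
  hence "1 / 2 * real n \<le> (1 - exp (- (44 * L))) * real n" by (intro mult_right_mono) auto
  hence one: "1 \<le> (1 - exp (- (44 * L))) * real n" using n2 a by linarith
  have "f n r s \<le> max 1 (n - n div a)"
    unfolding a_def using A by (intro palette_bound npos r) auto
  moreover have "n div a \<le> n" by simp
  ultimately have "real (f n r s) \<le> max 1 (real n - real (n div a))" by linarith
  thus ?thesis using loss one by (simp add: algebra_simps)
qed

lemma ln_2_le: "ln 2 \<le> (7 / 10 :: real)"
proof -
  have "(2::real) \<le> (1 + 7 / 40 + (7 / 40)\<^sup>2 / 2) ^ 4" by (simp add: power2_eq_square power4_eq_xxxx)
  also have "\<dots> \<le> exp (7 / 40) ^ 4"
    by (intro power_mono exp_lower_Taylor_quadratic) auto
  also have "\<dots> = exp (7 / 10)" by (simp flip: exp_of_nat_mult)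
  finally show ?thesis by (metis exp_ln exp_le_cancel_iff zero_less_numeral)
qed

theorem theorem1p3:
  "\<exists>c C :: real. \<exists>N :: nat \<Rightarrow> nat. c > 0 \<and> C > 0 \<and>
     (\<forall>s :: nat \<Rightarrow> nat.
        (\<forall>\<^sub>F r in sequentially. sqrt (real r * log 2 (real r)) \<le> real (s r)) \<longrightarrow>
        (\<lambda>r. real (s r)) \<in> o(\<lambda>r. real r) \<longrightarrow>
        (\<forall>\<^sub>F r in sequentially. \<forall>n \<ge> N r.
           (1 - exp (- c * (real (s r))\<^sup>2 / real r)) * real n \<le> real (f n r (s r)) \<and>
           real (f n r (s r)) \<le> (1 - exp (- C * (real (s r))\<^sup>2 / real r)) * real n))"
proof (intro exI conjI allI impI)
  show "(0::real) < 1 / 200" "(0::real) < 44" by simp_all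
  fix s :: "nat \<Rightarrow> nat"
  assume large: "\<forall>\<^sub>F r in sequentially. sqrt (real r * log 2 (real r)) \<le> real (s r)"
    and small: "(\<lambda>r. real (s r)) \<in> o(\<lambda>r. real r)"
  have "\<forall>\<^sub>F r in sequentially. norm (real (s r)) \<le> 1 / 20 * norm (real r)"
    by (rule landau_o.smallD[OF small]) simp
  moreover have "\<forall>\<^sub>F r in sequentially. (400::real) \<le> log 2 (real r)"
    using eventually_ge_at_top[of "nat \<lceil>2 powr 400 :: real\<rceil>"]
  proof eventually_elim
    case (elim r)
    hence r: "2 powr 400 \<le> real r" by linarith
    moreover have "0 < real r" using r powr_gt_zero[of 2 400] by linarith
    ultimately show ?case by (simp add: le_log_iff)
  qed
  ultimately show "\<forall>\<^sub>F r in sequentially. \<forall>n \<ge> nat \<lceil>2 * exp (43 * real r)\<rceil>.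
           (1 - exp (- (1 / 200) * (real (s r))\<^sup>2 / real r)) * real n \<le> real (f n r (s r)) \<and>
           real (f n r (s r)) \<le> (1 - exp (- 44 * (real (s r))\<^sup>2 / real r)) * real n"
    using large eventually_gt_at_top[of 0]
  proof eventually_elim
    case (elim r)
    define L where "L = (real (s r))\<^sup>2 / real r"
    have r: "0 < r" by (rule elim(4))
    have sr: "20 * s r \<le> r" using elim(1) by simp
    have "real r * log 2 (real r) \<le> (real (s r))\<^sup>2" using elim(3) by (rule sqrt_le_D)
    hence logL: "log 2 (real r) \<le> L" using r by (simp add: L_def field_simps)
    have L: "400 \<le> L" using logL elim(2) by linarith
    have "ln (real r) = log 2 (real r) * ln 2" using r by (simp add: log_def)
    also have "\<dots> \<le> L * (7 / 10)"
      using logL elim(2) ln_2_le by (intro mult_mono) auto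
    finally have ln: "ln (real r) \<le> 7 / 10 * L" by simp
    show ?case
    proof (intro allI impI)
      fix n assume "nat \<lceil>2 * exp (43 * real r)\<rceil> \<le> n"
      hence n: "2 * exp (43 * real r) \<le> real n" by linarith
      hence npos: "0 < n" using exp_gt_zero[of "43 * real r"] by (cases "n = 0") auto
      have "(1 - exp (- (L / 200))) * real n \<le> real (f n r (s r))"
        unfolding L_def by (rule f_lower_bound) (use npos sr L ln in \<open>auto simp: L_def\<close>)
      moreover have "real (f n r (s r)) \<le> (1 - exp (- (44 * L))) * real n"
        unfolding L_def by (rule f_upper_bound) (use sr L ln n in \<open>auto simp: L_def\<close>)
      ultimately show "(1 - exp (- (1 / 200) * (real (s r))\<^sup>2 / real r)) * real n \<le> real (f n r (s r)) \<and>
           real (f n r (s r)) \<le> (1 - exp (- 44 * (real (s r))\<^sup>2 / real r)) * real n"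
        by (simp add: L_def mult.commute)
    qed
  qed
qed

end
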